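(* Assume $\Omega^*\neq\emptyset$ and let $\sigma\in[0,c]$. Let $\{\omega_k\}$ be generated by the iteration below. Suppose there exist entrywise positive $\theta^*\in\mathbb{R}^{d\times n}$, $\beta^*\in\mathbb{R}^{m\times n}$, a constant $\kappa>0$ and an integer $K_0>0$ such that for every $k\ge K_0$ the error bound condition $$\operatorname{dist}^2_{\mathcal{H}^*}(\widetilde\omega,\Omega^* )\le\frac{\kappa}{16}\,\|\widetilde\omega-\omega_k\|^2_{\mathcal{H}^*},\qquad \widetilde\omega=\mathcal{T}(A,\theta^*,\beta^* )(\omega_k),$$ holds, where $\mathcal{H}^*$ is the operator $\mathcal{H}$ built from the parameters $(A,\theta^*,\beta^* )$. Then there exist parameters $(W_k,\theta_k,\beta_k)\in\mathcal{S}(\sigma,A)$ and a constant $\gamma\in(0,1)$ such that $$\operatorname{dist}^2_{\mathcal{H}_{k+1}}(\omega_{k+1},\Omega^* )<\gamma\,\operatorname{dist}^2_{\mathcal{H}_k}(\omega_k,\Omega^* ),$$ i.e. $\operatorname{dist}^2_{\mathcal{H}_k}(\omega_k,\Omega^* )$ converges to zero linearly.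
   Context: Let $A\in\mathbb{R}^{m\times d}$, $X\in\mathbb{R}^{m\times n}$, and let $f:\mathbb{R}^{d\times n}\to\mathbb{R}$, $g:\mathbb{R}^{m\times n}\to\mathbb{R}$ be convex. Consider the problem $\min_{Z,E} f(Z)+g(E)$ subject to $X=AZ+E$. Triples are written $\omega=(Z,E,-\lambda)$ with $\lambda\in\mathbb{R}^{m\times n}$ a Lagrange multiplier; the inner product of triples is the sum of componentwise Frobenius inner products. $\Omega^*$ is the solution set: the set of $\omega^*=(Z^*,E^*,-\lambda^* )$ with $0\in\partial f(Z^* )+A^\top\lambda^*$, $0\in\partial g(E^* )+\lambda^*$, $AZ^*+E^*=X$. $\circ$ is the Hadamard product; $\beta^{-1}$ is the entrywise reciprocal; $\tfrac{\theta}{2}\circ\|M\|_F^2:=\tfrac12\sum_{ij}\theta_{ij}M_{ij}^2$. Iteration (D-LADMM), with parameters $W_k\in\mathbb{R}^{m\times d}$, $\theta_k\in\mathbb{R}^{d\times n}$, $\beta_k\in\mathbb{R}^{m\times n}$: $Z_{k+1}=\arg\min_Z\{ f(Z)+\tfrac{\theta_k}{2}\circ\|Z-Z_k+\theta_k^{-1}\circ W_k^\top(\lambda_k+\beta_k\circ(AZ_k+E_k-X))\|_F^2\}$, $E_{k+1}=\arg\min_E\{g(E)+\tfrac{\beta_k}{2}\circ\|E-X+AZ_{k+1}+\beta_k^{-1}\circ\lambda_k\|_F^2\}$, $\lambda_{k+1}=\lambda_k+\beta_k\circ(AZ_{k+1}+E_{k+1}-X)$. $\mathcal{T}(W,\theta,\beta)$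 denotes the map sending $\omega_k$ to $\omega_{k+1}$ under one step of this iteration with parameters $(W_k,\theta_k,\beta_k)=(W,\theta,\beta)$. For parameters $(W,\theta,\beta)$: $\mathcal{D}(Z)=\theta\circ Z-W^\top(\beta\circ(AZ))$ and $\mathcal{H}(Z,E,-\lambda)=(\mathcal{D}(Z),\ \beta\circ E,\ \beta^{-1}\circ(-\lambda))$; $\mathcal{H}_k$ is this operator for $(W_k,\theta_k,\beta_k)$. $\|\omega\|_{\mathcal{H}}^2=\langle\omega,\mathcal{H}(\omega)\rangle$; $\operatorname{dist}^2_{\mathcal{H}}(\omega,\Omega^* )=\min_{\omega^*\in\Omega^*}\|\omega-\omega^*\|^2_{\mathcal{H}}$. $\mathcal{S}(\sigma,A)$ is the set of $(W,\theta,\beta)$ with $\|W-A\|\le\sigma$ (spectral norm), $\theta,\beta$ entrywise positive, and $Z\mapsto\theta\circ Z-W^\top(\beta\circ(AZ))$ positive definite ($\langle\cdot(Z),Z\rangle>0$ for $Z\neq0$). Standing assumption: there is a constant $c$ such that $\mathcal{S}(\sigma,A)\ne\emptyset$ for all $0\le\sigma\le c$.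
   Formalization: The strict decrease fails once ω_k lies in Ω*, so "or both distances are 0" is added; the error bound is assumed along every sequence from ω_0 with parameters in S(σ,A), and the contraction is claimed for k ≥ K_0. *)

theory Defs
  imports "HOL-Analysis.Analysis"
begin

text \<open>Matrices are Cartesian-product types: an m x d matrix is (real^'d^'m)
 (rows indexed by 'm, columns by 'd). A triple omega = (Z, E, -lambda) is a
 Z x E x (-lambda) product; its third component stores -lambda, as in the paper.\<close>

definition hprod :: "(real^'b^'a) \<Rightarrow> (real^'b^'a) \<Rightarrow> (real^'b^'a)" where
  "hprod M N = (\<chi> i j. M $ i $ j * N $ i $ j)"

definition recip :: "(real^'b^'a) \<Rightarrow> (real^'b^'a)" where
  "recip M = (\<chi> i j. inverse (M $ i $ j))"

definition frob :: "(real^'b^'a) \<Rightarrow> (real^'b^'a) \<Rightarrow> real" where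
  "frob M N = (\<Sum>i\<in>UNIV. \<Sum>j\<in>UNIV. M $ i $ j * N $ i $ j)"

definition wsq :: "(real^'b^'a) \<Rightarrow> (real^'b^'a) \<Rightarrow> real" where
  "wsq \<theta> M = (1/2) * (\<Sum>i\<in>UNIV. \<Sum>j\<in>UNIV. \<theta> $ i $ j * (M $ i $ j)^2)"

definition entrywise_pos :: "(real^'b^'a) \<Rightarrow> bool" where
  "entrywise_pos M \<longleftrightarrow> (\<forall>i j. M $ i $ j > 0)"

definition subgrad :: "((real^'b^'a) \<Rightarrow> real) \<Rightarrow> (real^'b^'a) \<Rightarrow> ((real^'b^'a)) set" where
  "subgrad f Z = {G. \<forall>Y. f Y \<ge> f Z + frob G (Y - Z)}"

definition Omega_star ::
  "((real^'n^'d) \<Rightarrow> real) \<Rightarrow> ((real^'n^'m) \<Rightarrow> real) \<Rightarrow> (real^'d^'m) \<Rightarrow> (real^'n^'m)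
   \<Rightarrow> ((real^'n^'d) \<times> (real^'n^'m) \<times> (real^'n^'m)) set" where
  "Omega_star f g A X = {(Z, E, - lam) | Z E lam.
       0 \<in> (\<lambda>G. G + transpose A ** lam) ` subgrad f Z \<and>
       0 \<in> (\<lambda>G. G + lam) ` subgrad g E \<and>
       A ** Z + E = X}"

definition ladmm_step ::
  "((real^'n^'d) \<Rightarrow> real) \<Rightarrow> ((real^'n^'m) \<Rightarrow> real) \<Rightarrow> (real^'d^'m) \<Rightarrow> (real^'n^'m)
   \<Rightarrow> (real^'d^'m) \<times> (real^'n^'d) \<times> (real^'n^'m)
   \<Rightarrow> (real^'n^'d) \<times> (real^'n^'m) \<times> (real^'n^'m)
   \<Rightarrow> (real^'n^'d) \<times> (real^'n^'m) \<times> (real^'n^'m)" where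
  "ladmm_step f g A X P \<omega> =
    (case P of (W, \<theta>, \<beta>) \<Rightarrow> case \<omega> of (Zk, Ek, mlam) \<Rightarrow>
      (let lam = - mlam;
           Zn = (THE Z. \<forall>Y.
              f Z + wsq \<theta> (Z - Zk + hprod (recip \<theta>)
                   (transpose W ** (lam + hprod \<beta> (A ** Zk + Ek - X))))
              \<le> f Y + wsq \<theta> (Y - Zk + hprod (recip \<theta>)
                   (transpose W ** (lam + hprod \<beta> (A ** Zk + Ek - X)))));
           En = (THE E. \<forall>Y.
              g E + wsq \<beta> (E - X + A ** Zn + hprod (recip \<beta>) lam)
              \<le> g Y + wsq \<beta> (Y - X + A ** Zn + hprod (recip \<beta>) lam));
           lamn = lam + hprod \<beta> (A ** Zn + En - X)
       in (Zn, En, - lamn)))"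

definition Dop :: "(real^'d^'m) \<Rightarrow> (real^'d^'m) \<Rightarrow> (real^'n^'d) \<Rightarrow> (real^'n^'m)
   \<Rightarrow> (real^'n^'d) \<Rightarrow> (real^'n^'d)" where
  "Dop A W \<theta> \<beta> Z = hprod \<theta> Z - transpose W ** hprod \<beta> (A ** Z)"

text \<open>||omega||_H^2 = <omega, H(omega)>, with H(Z,E,-lambda) = (D Z, beta o E, beta^-1 o (-lambda)).\<close>
definition Hnormsq :: "(real^'d^'m) \<Rightarrow> (real^'d^'m) \<times> (real^'n^'d) \<times> (real^'n^'m)
   \<Rightarrow> (real^'n^'d) \<times> (real^'n^'m) \<times> (real^'n^'m) \<Rightarrow> real" where
  "Hnormsq A P \<omega> = (case P of (W, \<theta>, \<beta>) \<Rightarrow> case \<omega> of (Z, E, M) \<Rightarrow>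
      frob Z (Dop A W \<theta> \<beta> Z) + frob E (hprod \<beta> E) + frob M (hprod (recip \<beta>) M))"

text \<open>dist_H^2(omega, Omega^*) (infimum over Omega^*; the paper writes min).\<close>
definition dist2H :: "((real^'n^'d) \<Rightarrow> real) \<Rightarrow> ((real^'n^'m) \<Rightarrow> real) \<Rightarrow> (real^'d^'m) \<Rightarrow> (real^'n^'m)
   \<Rightarrow> (real^'d^'m) \<times> (real^'n^'d) \<times> (real^'n^'m)
   \<Rightarrow> (real^'n^'d) \<times> (real^'n^'m) \<times> (real^'n^'m) \<Rightarrow> real" where
  "dist2H f g A X P \<omega> = Inf ((\<lambda>\<omega>s. Hnormsq A P (\<omega> - \<omega>s)) ` Omega_star f g A X)"

text \<open>The set S(sigma, A); spectral norm = operator norm of the linear map.\<close>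
definition Sset :: "real \<Rightarrow> (real^'d^'m) \<Rightarrow> ((real^'d^'m) \<times> (real^'n^'d) \<times> (real^'n^'m)) set" where
  "Sset \<sigma> A = {(W, \<theta>, \<beta>). onorm (\<lambda>x. (W - A) *v x) \<le> \<sigma> \<and>
       entrywise_pos \<theta> \<and> entrywise_pos \<beta> \<and>
       (\<forall>Z. Z \<noteq> 0 \<longrightarrow> frob (Dop A W \<theta> \<beta> Z) Z > 0)}"

fun ladmm_seq ::
  "((real^'n^'d) \<Rightarrow> real) \<Rightarrow> ((real^'n^'m) \<Rightarrow> real) \<Rightarrow> (real^'d^'m) \<Rightarrow> (real^'n^'m)
   \<Rightarrow> (nat \<Rightarrow> (real^'d^'m) \<times> (real^'n^'d) \<times> (real^'n^'m))
   \<Rightarrow> (real^'n^'d) \<times> (real^'n^'m) \<times> (real^'n^'m)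
   \<Rightarrow> nat \<Rightarrow> (real^'n^'d) \<times> (real^'n^'m) \<times> (real^'n^'m)" where
  "ladmm_seq f g A X P \<omega>0 0 = \<omega>0"
| "ladmm_seq f g A X P \<omega>0 (Suc k) = ladmm_step f g A X (P k) (ladmm_seq f g A X P \<omega>0 k)"

end

theory Submission
  imports Defs
begin

text \<open>The parameters are constant, \<open>(A, t \<theta>*, \<beta>*)\<close> with \<open>t\<close> so large that \<open>\<D>\<close> is positive definite.
  For such parameters monotonicity of the subdifferentials gives
  \<open>\<parallel>\<omega>' - \<omega>*\<parallel>\<^sup>2 + \<parallel>\<omega>' - \<omega>\<parallel>\<^sup>2 \<le> \<parallel>\<omega> - \<omega>*\<parallel>\<^sup>2\<close> in the \<open>\<H>\<close>-norm, so linear convergence follows from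
  \<open>dist\<^sup>2(\<omega>', \<Omega>*) \<le> L \<parallel>\<omega>' - \<omega>\<parallel>\<^sup>2\<close>.
  The assumed error bound is for \<open>(A, \<theta>*, \<beta>*)\<close>, where \<open>\<H>*\<close> may be indefinite. It transfers nevertheless:
  the dual update makes the feasibility residual of the trial step equal to \<open>\<beta>\<^sup>-\<^sup>1 \<circ> (\<lambda>' - \<lambda>)\<close>, and modulo that
  residual \<open>\<H>*\<close> is coercive; moreover the trial steps for \<open>\<theta>*\<close> and \<open>t \<theta>*\<close> differ by at most a
  constant times \<open>\<parallel>\<omega>' - \<omega>\<parallel>\<close>.\<close>

section \<open>Algebra of the Hadamard product and the Frobenius inner product\<close>

lemma frob_eq_inner: "frob M N = M \<bullet> N"
  by (simp add: frob_def inner_vec_def)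

lemma inner_hprod_left: "hprod \<theta> x \<bullet> y = x \<bullet> hprod \<theta> y"
  by (simp add: hprod_def inner_vec_def mult_ac)

lemma linear_hprod: "linear (hprod \<theta>)"
  by (rule linearI) (simp_all add: hprod_def vec_eq_iff algebra_simps)

lemma hprod_scaleR_left: "hprod (t *\<^sub>R \<theta>) x = t *\<^sub>R hprod \<theta> x"
  by (simp add: hprod_def vec_eq_iff)

lemma hprod_recip:
  assumes "entrywise_pos \<beta>"
  shows "hprod \<beta> (hprod (recip \<beta>) x) = x" "hprod (recip \<beta>) (hprod \<beta> x) = x"
  using assms by (simp_all add: hprod_def recip_def entrywise_pos_def vec_eq_iff less_imp_neq[THEN not_sym])

lemma entrywise_pos_recip: "entrywise_pos \<beta> \<Longrightarrow> entrywise_pos (recip \<beta>)"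
  by (simp add: entrywise_pos_def recip_def)

lemma entrywise_pos_coercive:
  fixes \<theta> :: "real^'b^'a"
  assumes "entrywise_pos \<theta>"
  obtains c where "c > 0" "\<And>x. c * (norm x)\<^sup>2 \<le> x \<bullet> hprod \<theta> x"
proof
  \<comment> \<open>The matrix has finitely many entries, so the smallest is attained, hence
    positive, and serves as the constant.\<close>
  define c where "c = Min (range (\<lambda>p. \<theta> $ fst p $ snd p))"
  have "c \<in> range (\<lambda>p. \<theta> $ fst p $ snd p)"
    unfolding c_def by (rule Min_in) auto
  then show "c > 0" using assms by (auto simp: entrywise_pos_def)
  have le: "c \<le> \<theta> $ i $ j" for i j
    unfolding c_def by (rule Min_le) (auto intro: rev_image_eqI[of "(i,j)"])
  show "c * (norm x)\<^sup>2 \<le> x \<bullet> hprod \<theta> x" for x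
    unfolding power2_norm_eq_inner inner_vec_def hprod_def sum_distrib_left
    by (intro sum_mono) (use le in \<open>auto simp: mult.left_commute intro: mult_right_mono\<close>)
qed

lemma linear_matrix_mult: "linear (\<lambda>Z. A ** (Z :: real^'n^'d))"
  by (rule linearI) (simp_all add: matrix_matrix_mult_def vec_eq_iff
      sum_distrib_left distrib_left sum.distrib mult_ac)

lemma transpose_mult_inner:
  fixes A :: "real^'d^'m" and V :: "real^'n^'m"
  shows "(transpose A ** V) \<bullet> Z = V \<bullet> (A ** Z)"
proof -
  have "(transpose A ** V) \<bullet> Z = (\<Sum>i\<in>UNIV. \<Sum>j\<in>UNIV. \<Sum>k\<in>UNIV. A $ k $ i * V $ k $ j * Z $ i $ j)"
    by (simp add: inner_vec_def matrix_matrix_mult_def transpose_def sum_distrib_right)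
  also have "\<dots> = (\<Sum>k\<in>UNIV. \<Sum>j\<in>UNIV. \<Sum>i\<in>UNIV. A $ k $ i * V $ k $ j * Z $ i $ j)"
    by (subst sum.swap, subst sum.swap[of _ _ "UNIV::'d set"], intro sum.cong refl) (rule sum.swap)
  also have "\<dots> = V \<bullet> (A ** Z)"
    by (simp add: inner_vec_def matrix_matrix_mult_def sum_distrib_left mult_ac)
  finally show ?thesis .
qed

lemma linear_norm_bound:
  fixes L :: "'a::euclidean_space \<Rightarrow> 'b::real_normed_vector"
  assumes "linear L"
  obtains K where "K > 0" "\<And>x. norm (L x) \<le> K * norm x"
  using linear_bounded_pos[OF assms] by (auto simp: mult.commute)

section \<open>Subgradients and weighted proximal minimisation\<close>

lemma wsq_eq_inner: "wsq \<theta> M = (M \<bullet> hprod \<theta> M) / 2"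
  by (simp add: wsq_def inner_vec_def hprod_def power2_eq_square mult_ac)

lemma subgrad_mono:
  assumes "G \<in> subgrad f x" "H \<in> subgrad f y"
  shows "(G - H) \<bullet> (x - y) \<ge> 0"
proof -
  have "f y \<ge> f x + G \<bullet> (y - x)" "f x \<ge> f y + H \<bullet> (x - y)"
    using assms by (auto simp: subgrad_def frob_eq_inner)
  then show ?thesis by (simp add: inner_simps)
qed

text \<open>Convexity along the ray from 0 through \<open>x\<close> carries a bound \<open>B\<close>
  on the unit ball to the whole space: \<open>f\<close> falls at most linearly. This lets the
  quadratic term dominate in \<open>prox_exists\<close>.\<close>

lemma convex_lower_bound:
  fixes f :: "'a::euclidean_space \<Rightarrow> real"
  assumes "convex_on UNIV f"
  obtains a b where "a \<ge> 0" "\<And>x. f x \<ge> - a * norm x - b"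
proof -
  have cont: "continuous_on S f" for S
    using convex_on_continuous[OF open_UNIV assms] continuous_on_subset by blast
  have "compact (f ` cball 0 1)"
    by (intro compact_continuous_image cont compact_cball)
  then have "bounded (f ` cball 0 1)"
    by (rule compact_imp_bounded)
  then obtain B where "\<forall>y\<in>f ` cball 0 1. norm y \<le> B"
    unfolding bounded_iff by blast
  then have B: "\<bar>f x\<bar> \<le> B" if "norm x \<le> 1" for x
    using that by simp
  have B0: "B \<ge> 0" using B[of 0] by auto
  show ?thesis
  proof
    show "2 * B \<ge> 0" using B0 by simp
    show "f x \<ge> - (2 * B) * norm x - B" for x
    proof (cases "norm x \<le> 1")
      case True
      then have "f x \<ge> - B" using B[of x] by auto
      moreover have "2 * B * norm x \<ge> 0" using B0 by simp
      ultimately show ?thesis by simp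
    next
      case False
      define t where "t = norm x"
      have t: "t > 1" using False by (simp add: t_def)
      \<comment> \<open>\<open>x\<close> divided by its norm is the convex combination of 0 and
        \<open>x\<close> that lies in the unit ball, where \<open>f\<close> is at least
        \<open>- B\<close>.\<close>
      have "f ((1 - 1/t) *\<^sub>R 0 + (1/t) *\<^sub>R x) \<le> (1 - 1/t) * f 0 + (1/t) * f x"
        using t by (intro convex_onD[OF assms]) auto
      moreover have "norm ((1/t) *\<^sub>R x) \<le> 1" using t by (simp add: t_def)
      then have "f ((1/t) *\<^sub>R x) \<ge> - B" using B by (meson abs_le_D2 minus_le_iff)
      ultimately have "- B \<le> (1 - 1/t) * f 0 + (1/t) * f x" by simp
      then have "t * (- B) \<le> t * ((1 - 1/t) * f 0 + (1/t) * f x)"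
        using t by (intro mult_left_mono) auto
      also have "\<dots> = (t - 1) * f 0 + f x" using t by (simp add: field_simps)
      also have "\<dots> \<le> (t - 1) * B + f x"
        using B[of 0] t by (auto intro: mult_left_mono)
      finally have "- (2 * t * B) + B \<le> f x" by (simp add: algebra_simps)
      then show ?thesis using B0 unfolding t_def by (simp add: mult_ac)
    qed
  qed
qed

text \<open>Outside a large ball the quadratic term outgrows the linear decrease of
  \<open>f\<close>, so the objective is at least its value at \<open>c\<close>; a minimiser over the
  compact ball is therefore global.\<close>

lemma prox_exists:
  fixes f :: "real^'b^'a \<Rightarrow> real"
  assumes conv: "convex_on UNIV f" and pos: "entrywise_pos \<theta>"
  shows "\<exists>x. \<forall>y. f x + wsq \<theta> (x - c) \<le> f y + wsq \<theta> (y - c)"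
proof -
  obtain a b where a: "a \<ge> 0" and ab: "\<And>x. f x \<ge> - a * norm x - b"
    using convex_lower_bound[OF conv] by blast
  obtain e where e: "e > 0" "\<And>x. e * (norm x)\<^sup>2 \<le> x \<bullet> hprod \<theta> x"
    using entrywise_pos_coercive[OF pos] by blast
  define h where "h x = f x + wsq \<theta> (x - c)" for x
  \<comment> \<open>The ball contains \<open>c\<close>. Outside it \<open>s = norm (y - c)\<close>
    satisfies \<open>s \<ge> 1\<close> and \<open>e * s \<ge> 2 * (a + D)\<close>, with
    \<open>D\<close> the absolute value occurring here, so
    \<open>e * s\<^sup>2 / 2 \<ge> a * s + D\<close>.\<close>
  define R where "R = max (norm c) (norm c + 2 * (a + \<bar>b + h c + a * norm c\<bar>) / e + 1)"
  have "continuous_on (cball 0 R) f"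
    using convex_on_continuous[OF open_UNIV conv] continuous_on_subset by blast
  then have cont: "continuous_on (cball 0 R) h"
    unfolding h_def wsq_eq_inner
    by (intro continuous_intros linear_continuous_on_compose[OF _ linear_hprod]) auto
  have "cball 0 R \<noteq> {}" by (auto simp: R_def intro!: exI[of _ c])
  then obtain x where x: "x \<in> cball 0 R" "\<And>y. y \<in> cball 0 R \<Longrightarrow> h x \<le> h y"
    using continuous_attains_inf[OF compact_cball _ cont] by blast
  have "h x \<le> h y" for y
  proof (cases "norm y \<le> R")
    case True then show ?thesis using x by simp
  next
    case False
    define s where "s = norm (y - c)"
    have ns: "norm y \<le> s + norm c" using norm_triangle_sub[of y c] by (simp add: s_def)
    define D where "D = \<bar>b + h c + a * norm c\<bar>"
    have "s \<ge> 2 * (a + D) / e + 1" using False ns unfolding R_def D_def by auto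
    moreover have "2 * (a + D) / e \<ge> 0" using a e(1) by (simp add: D_def)
    ultimately have s1: "s \<ge> 1" and "s \<ge> 2 * (a + D) / e" by linarith+
    then have "e * s \<ge> 2 * (a + D)" using e(1) by (simp add: field_simps)
    then have "s * (e * s) \<ge> s * (2 * (a + D))" by (intro mult_left_mono) (use s1 in auto)
    moreover have "s * D \<ge> D" using s1 by (simp add: D_def mult_le_cancel_right1)
    ultimately have "e * s\<^sup>2 / 2 \<ge> a * s + D" by (simp add: power2_eq_square algebra_simps)
    moreover have "h y \<ge> - a * norm y - b + e * s\<^sup>2 / 2"
      using ab[of y] e(2)[of "y - c"] by (simp add: h_def wsq_eq_inner s_def)
    moreover have "a * norm y \<le> a * s + a * norm c"
      using mult_left_mono[OF ns a] by (simp add: algebra_simps)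
    ultimately have "h y \<ge> h c" unfolding D_def by linarith
    moreover have "h x \<le> h c" by (rule x) (simp add: R_def)
    ultimately show ?thesis by simp
  qed
  then show ?thesis unfolding h_def by blast
qed

text \<open>Moving from \<open>x\<close> a fraction \<open>t\<close> towards \<open>y\<close>
  changes the objective by at most \<open>t * p + t * t * q\<close>, with \<open>p\<close> the
  first-order part. Minimality, division by \<open>t\<close> and the limit at 0 leave
  \<open>p \<ge> 0\<close>, the subgradient inequality.\<close>

lemma prox_subgrad:
  fixes f :: "real^'b^'a \<Rightarrow> real"
  assumes conv: "convex_on UNIV f"
    and min: "\<And>y. f x + wsq \<theta> (x - c) \<le> f y + wsq \<theta> (y - c)"
  shows "- hprod \<theta> (x - c) \<in> subgrad f x"
  unfolding subgrad_def frob_eq_inner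
proof (intro CollectI allI)
  fix y
  define d where "d = y - x"
  define p where "p = f y - f x + d \<bullet> hprod \<theta> (x - c)"
  define q where "q = (d \<bullet> hprod \<theta> d) / 2"
  have ineq: "0 \<le> p + t * q" if t: "0 < t" "t < 1" for t
  proof -
    have "f (x + t *\<^sub>R d) \<le> (1 - t) * f x + t * f y"
      using convex_onD[OF conv, of t x y] t by (simp add: d_def algebra_simps)
    moreover have "wsq \<theta> (x + t *\<^sub>R d - c) = wsq \<theta> (x - c) + t * (d \<bullet> hprod \<theta> (x - c)) + t * t * q"
    proof -
      have "wsq \<theta> (u + t *\<^sub>R d) = wsq \<theta> u + t * (d \<bullet> hprod \<theta> u) + t * t * q" for u
        using inner_hprod_left[of \<theta> d u]
        by (simp add: wsq_eq_inner linear_add[OF linear_hprod] linear_scale[OF linear_hprod]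
            inner_add_left inner_add_right q_def inner_commute[of u] field_simps)
      from this[of "x - c"] show ?thesis by (simp add: algebra_simps)
    qed
    ultimately have "0 \<le> t * (p + t * q)"
      using min[of "x + t *\<^sub>R d"] by (simp add: p_def algebra_simps)
    then show ?thesis using t by (simp add: zero_le_mult_iff)
  qed
  have "((\<lambda>t. p + t * q) \<longlongrightarrow> p + 0 * q) (at_right 0)"
    by (intro tendsto_intros)
  moreover have "\<forall>\<^sub>F t in at_right (0::real). 0 \<le> p + t * q"
    using eventually_at_right[of 0 "1::real"] ineq by (intro eventually_at_rightI[of 0 1]) auto
  ultimately have "0 \<le> p + 0 * q"
    by (intro tendsto_lowerbound[of _ _ "at_right (0::real)"]) auto
  then show "f y \<ge> f x + - hprod \<theta> (x - c) \<bullet> (y - x)"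
    by (simp add: p_def d_def inner_commute)
qed

text \<open>The iteration selects its minimisers by \<open>THE\<close>, so uniqueness is needed
  beside existence: for two minimisers, monotonicity applied to their optimality conditions bounds
  the coercive form of the difference by 0.\<close>

lemma prox_the:
  fixes f :: "real^'b^'a \<Rightarrow> real" and c :: "real^'b^'a"
  assumes conv: "convex_on UNIV f" and pos: "entrywise_pos \<theta>"
  defines "z \<equiv> THE x. \<forall>y. f x + wsq \<theta> (x - c) \<le> f y + wsq \<theta> (y - c)"
  shows "- hprod \<theta> (z - c) \<in> subgrad f z"
proof -
  let ?P = "\<lambda>x. \<forall>y. f x + wsq \<theta> (x - c) \<le> f y + wsq \<theta> (y - c)"
  obtain e where e: "e > 0" "\<And>x. e * (norm x)\<^sup>2 \<le> x \<bullet> hprod \<theta> x"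
    using entrywise_pos_coercive[OF pos] by blast
  have uniq: "x = y" if "?P x" "?P y" for x y
  proof -
    have "(- hprod \<theta> (x - c) - - hprod \<theta> (y - c)) \<bullet> (x - y) \<ge> 0"
      by (rule subgrad_mono[of _ f]; rule prox_subgrad[OF conv]) (use that in blast)+
    then have "(x - y) \<bullet> hprod \<theta> (x - y) \<le> 0"
      by (simp add: linear_diff[OF linear_hprod] inner_diff_left inner_diff_right inner_commute)
    then have "e * (norm (x - y))\<^sup>2 \<le> 0" using e(2)[of "x - y"] by linarith
    then show ?thesis using e(1) by (simp add: mult_le_0_iff)
  qed
  obtain x where "?P x" using prox_exists[OF conv pos] by blast
  then have "?P z" unfolding z_def by (rule theI) (use uniq \<open>?P x\<close> in blast)
  then show ?thesis by (intro prox_subgrad[OF conv]) blast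
qed

section \<open>Optimality conditions of one step and of the solution set\<close>

text \<open>With \<open>M\<close> storing \<open>- \<lambda>\<close>, both subproblems are proximal
  steps once the square is recentred. The optimality condition of the second contains exactly the
  dual update, so the new multiplier component is itself a subgradient of \<open>g\<close>.\<close>

lemma ladmm_step_subgrad:
  fixes f :: "real^'n^'d \<Rightarrow> real" and g :: "real^'n^'m \<Rightarrow> real"
  assumes "convex_on UNIV f" "convex_on UNIV g" "entrywise_pos \<theta>" "entrywise_pos \<beta>"
    and step: "ladmm_step f g A X (W, \<theta>, \<beta>) (Z, E, M) = (Z', E', M')"
  shows "transpose W ** (M - hprod \<beta> (A ** Z + E - X)) - hprod \<theta> (Z' - Z) \<in> subgrad f Z'"
    and "M' \<in> subgrad g E'"
    and "M' = M - hprod \<beta> (A ** Z' + E' - X)"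
proof -
  let ?v = "transpose W ** (- M + hprod \<beta> (A ** Z + E - X))"
  have Z': "Z' = (THE x. \<forall>Y. f x + wsq \<theta> (x - (Z - hprod (recip \<theta>) ?v))
      \<le> f Y + wsq \<theta> (Y - (Z - hprod (recip \<theta>) ?v)))"
    using step by (auto simp: ladmm_step_def Let_def algebra_simps)
  have E': "E' = (THE x. \<forall>Y. g x + wsq \<beta> (x - (X - A ** Z' - hprod (recip \<beta>) (- M)))
      \<le> g Y + wsq \<beta> (Y - (X - A ** Z' - hprod (recip \<beta>) (- M))))"
    using step by (auto simp: ladmm_step_def Let_def algebra_simps)
  show M': "M' = M - hprod \<beta> (A ** Z' + E' - X)"
    using step by (auto simp: ladmm_step_def Let_def)
  have "- hprod \<theta> (Z' - (Z - hprod (recip \<theta>) ?v)) \<in> subgrad f Z'"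
    unfolding Z' by (rule prox_the) fact+
  moreover have "- hprod \<theta> (Z' - (Z - hprod (recip \<theta>) ?v)) = - ?v - hprod \<theta> (Z' - Z)"
    using hprod_recip(1)[OF assms(3), of ?v]
    by (simp add: linear_diff[OF linear_hprod] linear_add[OF linear_hprod])
  moreover have "- ?v = transpose W ** (M - hprod \<beta> (A ** Z + E - X))"
    by (subst linear_neg[OF linear_matrix_mult, symmetric]) simp
  ultimately show "transpose W ** (M - hprod \<beta> (A ** Z + E - X)) - hprod \<theta> (Z' - Z) \<in> subgrad f Z'"
    by simp
  have "- hprod \<beta> (E' - (X - A ** Z' - hprod (recip \<beta>) (- M))) \<in> subgrad g E'"
    unfolding E' by (rule prox_the) fact+
  moreover have "- hprod \<beta> (E' - (X - A ** Z' - hprod (recip \<beta>) (- M))) = M'"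
    unfolding M' using hprod_recip(1)[OF assms(4), of "- M"]
    by (simp add: linear_diff[OF linear_hprod] linear_add[OF linear_hprod])
  ultimately show "M' \<in> subgrad g E'" by simp
qed

lemma Omega_star_iff:
  "(Z, E, M) \<in> Omega_star f g A X \<longleftrightarrow>
    transpose A ** M \<in> subgrad f Z \<and> M \<in> subgrad g E \<and> A ** Z + E = X"
proof -
  have neg: "transpose A ** (- M) = - (transpose A ** M)"
    by (rule linear_neg[OF linear_matrix_mult])
  have "(Z, E, M) \<in> Omega_star f g A X \<longleftrightarrow> 0 \<in> (\<lambda>G. G + transpose A ** (- M)) ` subgrad f Z \<and>
      0 \<in> (\<lambda>G. G + (- M)) ` subgrad g E \<and> A ** Z + E = X"
    unfolding Omega_star_def by (auto intro!: exI[of _ "- M"])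
  then show ?thesis by (auto simp: neg image_iff)
qed

section \<open>The quadratic form of \<open>\<H>\<close>: symmetry, bounds and coercivity\<close>

lemma Hnormsq_eq_inner:
  "Hnormsq A (W, \<theta>, \<beta>) (Z, E, M) =
    Z \<bullet> Dop A W \<theta> \<beta> Z + E \<bullet> hprod \<beta> E + M \<bullet> hprod (recip \<beta>) M"
  by (simp add: Hnormsq_def frob_eq_inner)

lemma inner_Dop:
  "Y \<bullet> Dop A A \<theta> \<beta> Z = Y \<bullet> hprod \<theta> Z - (A ** Y) \<bullet> hprod \<beta> (A ** Z)"
  by (simp add: Dop_def inner_diff_right) (metis inner_commute transpose_mult_inner)

lemma linear_Dop: "linear (Dop A W \<theta> \<beta>)"
  unfolding Dop_def
  by (intro linear_compose_sub linear_hprod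
      linear_compose[OF linear_compose[OF linear_matrix_mult linear_hprod] linear_matrix_mult, unfolded o_def])

lemma inner_Dop_commute: "Y \<bullet> Dop A A \<theta> \<beta> Z = Z \<bullet> Dop A A \<theta> \<beta> Y"
  unfolding inner_Dop by (metis inner_commute inner_hprod_left)

lemma norm_triple_sq: "(norm (x, y, z))\<^sup>2 = (norm x)\<^sup>2 + (norm y)\<^sup>2 + (norm z)\<^sup>2"
  by (simp add: norm_Pair)

text \<open>The absolute value is bounded because the estimate must also serve parameters for which
  the form can be negative.\<close>

lemma Hnormsq_upper:
  fixes A W :: "real^'d^'m" and \<theta> :: "real^'n^'d" and \<beta> :: "real^'n^'m"
  obtains K where "K > 0" "\<And>\<omega>. \<bar>Hnormsq A (W, \<theta>, \<beta>) \<omega>\<bar> \<le> K * (norm \<omega>)\<^sup>2"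
proof -
  have quad: "\<bar>x \<bullet> L x\<bar> \<le> K * (norm x)\<^sup>2" if "\<And>x. norm (L x) \<le> K * norm x"
    for L :: "'x::real_inner \<Rightarrow> 'x" and K x
  proof -
    have "\<bar>x \<bullet> L x\<bar> \<le> norm x * norm (L x)" by (rule Cauchy_Schwarz_ineq2)
    also have "\<dots> \<le> norm x * (K * norm x)" by (intro mult_left_mono that) auto
    finally show ?thesis by (simp add: power2_eq_square mult_ac)
  qed
  obtain K1 where K1: "K1 > 0" "\<And>x. norm (Dop A W \<theta> \<beta> x) \<le> K1 * norm x"
    using linear_norm_bound[OF linear_Dop] by blast
  obtain K2 where K2: "K2 > 0" "\<And>x. norm (hprod \<beta> x) \<le> K2 * norm x"
    using linear_norm_bound[OF linear_hprod] by blast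
  obtain K3 where K3: "K3 > 0" "\<And>x. norm (hprod (recip \<beta>) x) \<le> K3 * norm x"
    using linear_norm_bound[OF linear_hprod] by blast
  show ?thesis
  proof
    show "K1 + K2 + K3 > 0" using K1 K2 K3 by simp
    fix \<omega> :: "(real^'n^'d) \<times> (real^'n^'m) \<times> (real^'n^'m)"
    obtain Z E M where \<omega>: "\<omega> = (Z, E, M)" by (cases \<omega>)
    have "\<bar>Hnormsq A (W, \<theta>, \<beta>) \<omega>\<bar> \<le> K1 * (norm Z)\<^sup>2 + K2 * (norm E)\<^sup>2 + K3 * (norm M)\<^sup>2"
      using quad[OF K1(2), of Z] quad[OF K2(2), of E] quad[OF K3(2), of M]
      unfolding \<omega> Hnormsq_eq_inner by linarith
    also have "\<dots> \<le> (K1 + K2 + K3) * (norm Z)\<^sup>2 + (K1 + K2 + K3) * (norm E)\<^sup>2 + (K1 + K2 + K3) * (norm M)\<^sup>2"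
      using K1(1) K2(1) K3(1) by (intro add_mono mult_right_mono) auto
    finally show "\<bar>Hnormsq A (W, \<theta>, \<beta>) \<omega>\<bar> \<le> (K1 + K2 + K3) * (norm \<omega>)\<^sup>2"
      by (simp add: \<omega> norm_triple_sq algebra_simps)
  qed
qed

lemma Hnormsq_lower:
  fixes A W :: "real^'d^'m" and \<theta> :: "real^'n^'d" and \<beta> :: "real^'n^'m"
  assumes "entrywise_pos \<beta>" "c > 0" "\<And>Z. c * (norm Z)\<^sup>2 \<le> Z \<bullet> Dop A W \<theta> \<beta> Z"
  obtains e where "e > 0" "\<And>\<omega>. e * (norm \<omega>)\<^sup>2 \<le> Hnormsq A (W, \<theta>, \<beta>) \<omega>"
proof -
  obtain c2 where c2: "c2 > 0" "\<And>x. c2 * (norm x)\<^sup>2 \<le> x \<bullet> hprod \<beta> x"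
    using entrywise_pos_coercive[OF assms(1)] by blast
  obtain c3 where c3: "c3 > 0" "\<And>x. c3 * (norm x)\<^sup>2 \<le> x \<bullet> hprod (recip \<beta>) x"
    using entrywise_pos_coercive[OF entrywise_pos_recip[OF assms(1)]] by blast
  define e where "e = min c (min c2 c3)"
  show ?thesis
  proof
    show "e > 0" using assms(2) c2(1) c3(1) by (simp add: e_def)
    fix \<omega> :: "(real^'n^'d) \<times> (real^'n^'m) \<times> (real^'n^'m)"
    obtain Z E M where \<omega>: "\<omega> = (Z, E, M)" by (cases \<omega>)
    have "e * (norm \<omega>)\<^sup>2 = e * (norm Z)\<^sup>2 + e * (norm E)\<^sup>2 + e * (norm M)\<^sup>2"
      by (simp add: \<omega> norm_triple_sq algebra_simps)
    also have "\<dots> \<le> c * (norm Z)\<^sup>2 + c2 * (norm E)\<^sup>2 + c3 * (norm M)\<^sup>2"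
      by (intro add_mono mult_right_mono) (auto simp: e_def)
    also have "\<dots> \<le> Hnormsq A (W, \<theta>, \<beta>) \<omega>"
      unfolding \<omega> Hnormsq_eq_inner by (intro add_mono assms c2 c3)
    finally show "e * (norm \<omega>)\<^sup>2 \<le> Hnormsq A (W, \<theta>, \<beta>) \<omega>" .
  qed
qed

text \<open>\<open>Hnormsq\<close> may be indefinite here: its negative part \<open>- \<beta> \<circ> \<parallel>A Z\<parallel>\<^sup>2\<close> is cancelled by
  \<open>\<beta> \<circ> \<parallel>E\<parallel>\<^sup>2\<close> up to terms in the feasibility residual \<open>A Z + E\<close>, which \<open>N\<close> measures.\<close>

lemma Hnormsq_coercive_mod_residual:
  fixes A :: "real^'d^'m" and \<theta> :: "real^'n^'d" and \<beta> :: "real^'n^'m"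
  assumes "entrywise_pos \<theta>" "entrywise_pos \<beta>"
  obtains a b where "a > 0" "b > 0"
    "\<And>Z E M N. hprod \<beta> (A ** Z + E) = N \<Longrightarrow>
      (norm (Z, E, M))\<^sup>2 \<le> a * Hnormsq A (A, \<theta>, \<beta>) (Z, E, M) + b * (norm N)\<^sup>2"
proof -
  obtain c1 where c1: "c1 > 0" "\<And>x. c1 * (norm x)\<^sup>2 \<le> x \<bullet> hprod \<theta> x"
    using entrywise_pos_coercive[OF assms(1)] by blast
  obtain c2 where c2: "c2 > 0" "\<And>x. c2 * (norm x)\<^sup>2 \<le> x \<bullet> hprod \<beta> x"
    using entrywise_pos_coercive[OF assms(2)] by blast
  obtain c3 where c3: "c3 > 0" "\<And>x. c3 * (norm x)\<^sup>2 \<le> x \<bullet> hprod (recip \<beta>) x"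
    using entrywise_pos_coercive[OF entrywise_pos_recip[OF assms(2)]] by blast
  obtain K where K: "K > 0" "\<And>x::real^'n^'d. norm (A ** x) \<le> K * norm x"
    using linear_norm_bound[OF linear_matrix_mult] by blast
  obtain R where R: "R > 0" "\<And>x. norm (hprod (recip \<beta>) x) \<le> R * norm x"
    using linear_norm_bound[OF linear_hprod] by blast
  \<comment> \<open>The first entry of the maximum pays for \<open>Z\<close> and for the part of
    \<open>E\<close> controlled by \<open>Z\<close>, from the half of the \<open>\<theta>\<close>
    coercivity left over below; the second pays for \<open>M\<close>. The constant \<open>s\<close>
    comes from Young's inequality.\<close>
  define a where "a = max ((1 + 2 * K\<^sup>2) * 2 / c1) (1 / c3)"
  define s where "s = 2 * K\<^sup>2 / c1"
  have a: "a > 0" "1 + 2 * K\<^sup>2 \<le> a * (c1 / 2)" "1 \<le> a * c3"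
  proof -
    have "(1 + 2 * K\<^sup>2) * 2 / c1 \<le> a" "1 / c3 \<le> a" by (simp_all add: a_def)
    then show "1 + 2 * K\<^sup>2 \<le> a * (c1 / 2)" "1 \<le> a * c3"
      using c1(1) c3(1) by (simp_all add: field_simps)
    have "1 / c3 > 0" using c3(1) by simp
    with \<open>1 / c3 \<le> a\<close> show "a > 0" by linarith
  qed
  show ?thesis
  proof
    show "a > 0" by (fact a)
    show "a * s + 2 * R\<^sup>2 > 0" using a(1) c1(1) K R by (simp add: s_def add_pos_pos)
    fix Z :: "real^'n^'d" and E M N :: "real^'n^'m"
    assume N: "hprod \<beta> (A ** Z + E) = N"
    define r where "r = A ** Z + E"
    have E: "E = r - A ** Z" by (simp add: r_def)
    have N': "hprod \<beta> r = N" using N by (simp add: r_def)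
    have r: "r = hprod (recip \<beta>) N" using hprod_recip(2)[OF assms(2), of r] N' by simp
    define Q where "Q = Hnormsq A (A, \<theta>, \<beta>) (Z, E, M)"
    \<comment> \<open>Substituting \<open>E = r - A ** Z\<close> produces the term that cancels the
      negative part of \<open>Dop\<close>; the coupling that remains is between
      \<open>A ** Z\<close> and \<open>N\<close>.\<close>
    have "E \<bullet> hprod \<beta> E = r \<bullet> hprod \<beta> r - 2 * ((A ** Z) \<bullet> N) + (A ** Z) \<bullet> hprod \<beta> (A ** Z)"
    proof -
      have "r \<bullet> hprod \<beta> (A ** Z) = (A ** Z) \<bullet> N"
        using N' by (metis inner_commute inner_hprod_left)
      then show ?thesis using N'
        by (simp add: E linear_diff[OF linear_hprod] inner_diff_left inner_diff_right)
    qed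
    then have "Q = Z \<bullet> hprod \<theta> Z - 2 * ((A ** Z) \<bullet> N) + r \<bullet> hprod \<beta> r + M \<bullet> hprod (recip \<beta>) M"
      by (simp add: Q_def Hnormsq_eq_inner inner_Dop)
    moreover have "r \<bullet> hprod \<beta> r \<ge> 0"
      using c2(2)[of r] c2(1) by (meson order_trans mult_nonneg_nonneg less_imp_le zero_le_power2)
    \<comment> \<open>Young's inequality, weighted to spend half of the coercivity in
      \<open>Z\<close>.\<close>
    moreover have "2 * ((A ** Z) \<bullet> N) \<le> c1 / 2 * (norm Z)\<^sup>2 + s * (norm N)\<^sup>2"
    proof -
      have "(A ** Z) \<bullet> N \<le> norm (A ** Z) * norm N" by (rule norm_cauchy_schwarz)
      also have "\<dots> \<le> K * norm Z * norm N" by (intro mult_right_mono K) auto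
      finally have "2 * ((A ** Z) \<bullet> N) \<le> 2 * K * norm Z * norm N" by simp
      also have "\<dots> \<le> c1 / 2 * (norm Z)\<^sup>2 + s * (norm N)\<^sup>2"
      proof -
        have "0 \<le> (c1 * norm Z - 2 * K * norm N)\<^sup>2 / (2 * c1)" using c1(1) by simp
        also have "\<dots> = c1 / 2 * (norm Z)\<^sup>2 + s * (norm N)\<^sup>2 - 2 * K * norm Z * norm N"
          using c1(1) by (simp add: s_def power2_eq_square field_simps)
        finally show ?thesis by simp
      qed
      finally show ?thesis .
    qed
    ultimately have Q: "c1 / 2 * (norm Z)\<^sup>2 + c3 * (norm M)\<^sup>2 \<le> Q + s * (norm N)\<^sup>2"
      using c1(2)[of Z] c3(2)[of M] by linarith
    have "(norm E)\<^sup>2 \<le> 2 * R\<^sup>2 * (norm N)\<^sup>2 + 2 * K\<^sup>2 * (norm Z)\<^sup>2"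
    proof -
      have "norm E \<le> R * norm N + K * norm Z"
        using norm_triangle_ineq4[of r "A ** Z"] R(2)[of N] K(2)[of Z] by (simp add: E r)
      then have "(norm E)\<^sup>2 \<le> (R * norm N + K * norm Z)\<^sup>2" by (intro power_mono) auto
      also have "\<dots> \<le> 2 * (R * norm N)\<^sup>2 + 2 * (K * norm Z)\<^sup>2"
        using zero_le_power2[of "R * norm N - K * norm Z"] by (simp add: power2_sum power2_diff)
      finally show ?thesis by (simp add: power_mult_distrib)
    qed
    then have "(norm (Z, E, M))\<^sup>2 \<le> (1 + 2 * K\<^sup>2) * (norm Z)\<^sup>2 + 1 * (norm M)\<^sup>2 + 2 * R\<^sup>2 * (norm N)\<^sup>2"
      by (simp add: norm_triple_sq algebra_simps)
    also have "\<dots> \<le> a * (c1 / 2) * (norm Z)\<^sup>2 + a * c3 * (norm M)\<^sup>2 + 2 * R\<^sup>2 * (norm N)\<^sup>2"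
      by (intro add_mono mult_right_mono a) auto
    also have "\<dots> \<le> a * Q + (a * s + 2 * R\<^sup>2) * (norm N)\<^sup>2"
      using mult_left_mono[OF Q, of a] a(1) by (simp add: algebra_simps)
    finally show "(norm (Z, E, M))\<^sup>2 \<le> a * Hnormsq A (A, \<theta>, \<beta>) (Z, E, M) + (a * s + 2 * R\<^sup>2) * (norm N)\<^sup>2"
      by (simp add: Q_def)
  qed
qed

section \<open>Dependence of a step on \<open>\<theta>\<close>\<close>

text \<open>Both steps start at the same point with the same \<open>W\<close> and
  \<open>\<beta>\<close>, so the two conditions for \<open>Z\<close> differ only in the proximal
  terms. Monotonicity bounds \<open>Z1 - Z2\<close> by the movement \<open>Z2 - Z\<close>, and the
  updates of \<open>E\<close> and of the multiplier depend on the new \<open>Z\<close> in a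
  Lipschitz way.\<close>

lemma ladmm_step_theta_compare:
  fixes A W :: "real^'d^'m" and \<theta> \<theta>' :: "real^'n^'d" and \<beta> :: "real^'n^'m"
  assumes conv: "convex_on UNIV f" "convex_on UNIV g"
    and pos: "entrywise_pos \<theta>" "entrywise_pos \<theta>'" "entrywise_pos \<beta>"
  obtains C where "C > 0"
    "\<And>\<omega>. norm (ladmm_step f g A X (W, \<theta>, \<beta>) \<omega> - ladmm_step f g A X (W, \<theta>', \<beta>) \<omega>)
      \<le> C * norm (ladmm_step f g A X (W, \<theta>', \<beta>) \<omega> - \<omega>)"
proof -
  obtain c1 where c1: "c1 > 0" "\<And>x. c1 * (norm x)\<^sup>2 \<le> x \<bullet> hprod \<theta> x"
    using entrywise_pos_coercive[OF pos(1)] by blast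
  obtain c2 where c2: "c2 > 0" "\<And>x. c2 * (norm x)\<^sup>2 \<le> x \<bullet> hprod \<beta> x"
    using entrywise_pos_coercive[OF pos(3)] by blast
  obtain K1 where K1: "K1 > 0" "\<And>x. norm (hprod \<theta>' x - hprod \<theta> x) \<le> K1 * norm x"
    using linear_norm_bound[OF linear_compose_sub[OF linear_hprod linear_hprod]] by blast
  obtain K2 where K2: "K2 > 0" "\<And>x::real^'n^'d. norm (hprod \<beta> (A ** x)) \<le> K2 * norm x"
    using linear_norm_bound[OF linear_compose[OF linear_matrix_mult linear_hprod]] by auto
  obtain K3 where K3: "K3 > 0" "\<And>x. norm (hprod \<beta> x) \<le> K3 * norm x"
    using linear_norm_bound[OF linear_hprod] by blast
  have cancel: "norm x \<le> k / e * b" if "e > 0" "e * (norm x)\<^sup>2 \<le> norm x * (k * b)" "k > 0" "b \<ge> 0"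
    for x :: "'x::real_inner" and e k b :: real
  proof (cases "norm x = 0")
    case False
    then have "e * norm x \<le> k * b"
      using that(2) by (simp add: power2_eq_square mult.left_commute[of e])
    then show ?thesis using that(1) by (simp add: field_simps)
  qed (use that in simp)
  show ?thesis
  proof
    let ?C = "K1 / c1 * (1 + K2 / c2 + (K2 + K3 * (K2 / c2)))"
    show "?C > 0" using c1 c2 K1 K2 K3 by (simp add: add_pos_pos)
    fix \<omega> :: "(real^'n^'d) \<times> (real^'n^'m) \<times> (real^'n^'m)"
    obtain Z E M where \<omega>: "\<omega> = (Z, E, M)" by (cases \<omega>)
    obtain Z1 E1 M1 where s1: "ladmm_step f g A X (W, \<theta>, \<beta>) (Z, E, M) = (Z1, E1, M1)"
      by (metis prod_cases3)
    obtain Z2 E2 M2 where s2: "ladmm_step f g A X (W, \<theta>', \<beta>) (Z, E, M) = (Z2, E2, M2)"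
      by (metis prod_cases3)
    note st1 = ladmm_step_subgrad[OF conv pos(1,3) s1]
    note st2 = ladmm_step_subgrad[OF conv pos(2,3) s2]
    define z where "z = Z1 - Z2"
    define e where "e = E1 - E2"
    define b where "b = Z2 - Z"
    \<comment> \<open>Here \<open>z + b = Z1 - Z\<close>; the common terms with
      \<open>transpose W\<close> have cancelled.\<close>
    have "(hprod \<theta>' b - hprod \<theta> (z + b)) \<bullet> z \<ge> 0"
      using subgrad_mono[OF st1(1) st2(1)] by (simp add: z_def b_def)
    then have "z \<bullet> hprod \<theta> z \<le> z \<bullet> (hprod \<theta>' b - hprod \<theta> b)"
      by (simp add: linear_add[OF linear_hprod] inner_commute[of _ z] inner_simps)
    also have "\<dots> \<le> norm z * norm (hprod \<theta>' b - hprod \<theta> b)" by (rule norm_cauchy_schwarz)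
    also have "\<dots> \<le> norm z * (K1 * norm b)" by (intro mult_left_mono K1) auto
    finally have z: "norm z \<le> K1 / c1 * norm b"
      using c1(2)[of z] by (intro cancel c1 K1) auto
    have m: "M1 - M2 = - hprod \<beta> (A ** z) - hprod \<beta> e"
      unfolding st1(3) st2(3) z_def e_def
      by (simp add: linear_diff[OF linear_hprod] linear_add[OF linear_hprod] linear_diff[OF linear_matrix_mult])
    \<comment> \<open>The part of \<open>M1 - M2\<close> that contains \<open>e\<close> has the
      favourable sign, so \<open>e\<close> is controlled by \<open>z\<close> alone.\<close>
    have "(M1 - M2) \<bullet> e \<ge> 0" using subgrad_mono[OF st1(2) st2(2)] by (simp add: e_def)
    then have "e \<bullet> hprod \<beta> e \<le> e \<bullet> (- hprod \<beta> (A ** z))"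
      unfolding m by (simp add: inner_commute[of _ e] inner_simps)
    also have "\<dots> \<le> norm e * norm (- hprod \<beta> (A ** z))" by (rule norm_cauchy_schwarz)
    also have "\<dots> \<le> norm e * (K2 * norm z)" by (intro mult_left_mono) (auto simp: K2)
    finally have e: "norm e \<le> K2 / c2 * norm z"
      using c2(2)[of e] by (intro cancel c2 K2) auto
    have "norm (M1 - M2) \<le> norm (hprod \<beta> (A ** z)) + norm (hprod \<beta> e)"
      unfolding m using norm_triangle_ineq4[of "- hprod \<beta> (A ** z)" "hprod \<beta> e"] by simp
    also have "\<dots> \<le> K2 * norm z + K3 * (K2 / c2 * norm z)"
      using K2(2)[of z] K3(2)[of e] mult_left_mono[OF e, of K3] K3(1) by linarith
    finally have "norm (M1 - M2) \<le> (K2 + K3 * (K2 / c2)) * norm z" by (simp add: algebra_simps)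
    moreover have "norm (z, e, M1 - M2) \<le> norm z + norm e + norm (M1 - M2)"
      using norm_Pair_le[of z "(e, M1 - M2)"] norm_Pair_le[of e "M1 - M2"] by linarith
    ultimately have "norm (z, e, M1 - M2) \<le> (1 + K2 / c2 + (K2 + K3 * (K2 / c2))) * norm z"
      using e by (simp add: algebra_simps)
    also have "\<dots> \<le> (1 + K2 / c2 + (K2 + K3 * (K2 / c2))) * (K1 / c1 * norm b)"
      using c2 K2 K3 by (intro mult_left_mono z) (auto intro!: add_nonneg_nonneg)
    also have "\<dots> \<le> (1 + K2 / c2 + (K2 + K3 * (K2 / c2))) * (K1 / c1 * norm (b, E2 - E, M2 - M))"
      using c1 c2 K1 K2 K3 by (intro mult_left_mono norm_fst_le) (auto intro!: add_nonneg_nonneg)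
    finally show "norm (ladmm_step f g A X (W, \<theta>, \<beta>) \<omega> - ladmm_step f g A X (W, \<theta>', \<beta>) \<omega>)
      \<le> ?C * norm (ladmm_step f g A X (W, \<theta>', \<beta>) \<omega> - \<omega>)"
      by (simp add: \<omega> s1 s2 z_def e_def b_def mult_ac)
  qed
qed

section \<open>Descent towards the solution set\<close>

text \<open>In the \<open>\<H>\<close> form the displacement \<open>\<omega>' - \<omega>\<close>
  pairs nonpositively with \<open>\<omega>' - \<omega>s\<close>; polarisation turns this into the
  inequality. The pairing collects three monotonicity inequalities: for \<open>f\<close> and for
  \<open>g\<close> between new point and solution, and for \<open>g\<close> between consecutive
  points, where \<open>dual\<close> enters.\<close>

lemma ladmm_step_contraction:
  fixes A :: "real^'d^'m" and \<theta> :: "real^'n^'d" and \<beta> :: "real^'n^'m"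
  assumes conv: "convex_on UNIV f" "convex_on UNIV g"
    and pos: "entrywise_pos \<theta>" "entrywise_pos \<beta>"
    and sol: "\<omega>s \<in> Omega_star f g A X"
    and dual: "snd (snd \<omega>) \<in> subgrad g (fst (snd \<omega>))"
  defines "\<omega>' \<equiv> ladmm_step f g A X (A, \<theta>, \<beta>) \<omega>"
  shows "Hnormsq A (A, \<theta>, \<beta>) (\<omega>' - \<omega>s) + Hnormsq A (A, \<theta>, \<beta>) (\<omega>' - \<omega>)
    \<le> Hnormsq A (A, \<theta>, \<beta>) (\<omega> - \<omega>s)"
proof -
  obtain Z E M where \<omega>: "\<omega> = (Z, E, M)" by (cases \<omega>)
  obtain Zs Es Ms where \<omega>s: "\<omega>s = (Zs, Es, Ms)" by (cases \<omega>s)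
  obtain Z' E' M' where s: "ladmm_step f g A X (A, \<theta>, \<beta>) (Z, E, M) = (Z', E', M')"
    by (metis prod_cases3)
  note st = ladmm_step_subgrad[OF conv pos s]
  have opt: "transpose A ** Ms \<in> subgrad f Zs" "Ms \<in> subgrad g Es" "A ** Zs + Es = X"
    using sol by (auto simp: \<omega>s Omega_star_iff)
  define z e \<mu> where "z = Z' - Z" and "e = E' - E" and "\<mu> = M' - M"
  define p q \<nu> where "p = Z' - Zs" and "q = E' - Es" and "\<nu> = M' - Ms"
  let ?B = "hprod \<beta>" and ?R = "hprod (recip \<beta>)" and ?D = "Dop A A \<theta> \<beta>"
  have \<mu>: "\<mu> = - ?B (A ** p + q)"
    using st(3) opt(3) by (simp add: \<mu>_def p_def q_def linear_diff[OF linear_matrix_mult] algebra_simps)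
  have res: "A ** p + q = - ?R \<mu>"
    unfolding \<mu> by (simp add: linear_neg[OF linear_hprod] hprod_recip[OF pos(2)])
  \<comment> \<open>Rewrites the multiplier used by the update of \<open>Z\<close> relative to
    \<open>M'\<close>: the part \<open>A ** z\<close> of the correction completes
    \<open>Dop\<close>, the part \<open>e\<close> leads to the cross term.\<close>
  have shift: "M - ?B (A ** Z + E - X) = M' + ?B (A ** z + e)"
    unfolding st(3) z_def e_def
    by (simp add: linear_diff[OF linear_hprod] linear_add[OF linear_hprod] linear_diff[OF linear_matrix_mult])
  have "(transpose A ** (M' + ?B (A ** z + e)) - hprod \<theta> z - transpose A ** Ms) \<bullet> p \<ge> 0"
    using subgrad_mono[OF st(1) opt(1)] by (simp add: shift z_def p_def)
  then have f_mono: "0 \<le> (\<nu> + ?B (A ** z + e)) \<bullet> (A ** p) - hprod \<theta> z \<bullet> p"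
    by (simp add: \<nu>_def inner_diff_left inner_add_left transpose_mult_inner)
  have g_mono: "0 \<le> \<nu> \<bullet> q"
    using subgrad_mono[OF st(2) opt(2)] by (simp add: \<nu>_def q_def)
  have "M \<in> subgrad g E" using dual by (simp add: \<omega>)
  then have cross: "0 \<le> \<mu> \<bullet> e"
    using subgrad_mono[OF st(2)] by (simp add: \<mu>_def e_def)
  have "p \<bullet> ?D z + q \<bullet> ?B e + \<nu> \<bullet> ?R \<mu> \<le> 0"
  proof -
    have "p \<bullet> ?D z = hprod \<theta> z \<bullet> p - ?B (A ** z) \<bullet> (A ** p)"
      by (simp add: inner_Dop inner_commute)
    \<comment> \<open>The residual \<open>A ** p + q\<close> is a rescaled dual step, so the
      leftover coupling of the two updates becomes the monotone cross term.\<close>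
    moreover have "q \<bullet> ?B e + ?B e \<bullet> (A ** p) = - (\<mu> \<bullet> e)"
    proof -
      have "q \<bullet> ?B e + ?B e \<bullet> (A ** p) = ?B e \<bullet> (A ** p + q)"
        by (simp add: inner_add_right inner_commute)
      also have "\<dots> = - (?R (?B e) \<bullet> \<mu>)" by (simp add: res inner_hprod_left)
      finally show ?thesis by (simp add: hprod_recip[OF pos(2)] inner_commute)
    qed
    moreover have "\<nu> \<bullet> ?R \<mu> = - (\<nu> \<bullet> (A ** p)) - \<nu> \<bullet> q"
    proof -
      have "?R \<mu> = - (A ** p + q)" by (simp add: res)
      then show ?thesis by (simp add: inner_simps)
    qed
    ultimately show ?thesis
      using f_mono g_mono cross by (simp add: inner_add_left linear_add[OF linear_hprod])
  qed
  \<comment> \<open>Polarisation; the mixed terms combine because \<open>Dop A A\<close> is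
    symmetric, which relies on \<open>W = A\<close>.\<close>
  moreover have "Hnormsq A (A, \<theta>, \<beta>) (p - z, q - e, \<nu> - \<mu>) =
      Hnormsq A (A, \<theta>, \<beta>) (p, q, \<nu>) + Hnormsq A (A, \<theta>, \<beta>) (z, e, \<mu>)
      - 2 * (p \<bullet> ?D z + q \<bullet> ?B e + \<nu> \<bullet> ?R \<mu>)"
    unfolding Hnormsq_eq_inner
    using inner_Dop_commute[of z A \<theta> \<beta> p] inner_hprod_left[of \<beta> q e] inner_hprod_left[of "recip \<beta>" \<nu> \<mu>]
    by (simp add: linear_diff[OF linear_hprod] linear_diff[OF linear_Dop] inner_diff_left
        inner_diff_right inner_commute)
  moreover have "\<omega> - \<omega>s = (p - z, q - e, \<nu> - \<mu>)" "\<omega>' - \<omega>s = (p, q, \<nu>)" "\<omega>' - \<omega> = (z, e, \<mu>)"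
    by (simp_all add: \<omega>'_def \<omega> \<omega>s s p_def q_def \<nu>_def z_def e_def \<mu>_def)
  ultimately show ?thesis by simp
qed

text \<open>Provides the hypothesis \<open>dual\<close> of \<open>ladmm_step_contraction\<close> at
  every iterate after the arbitrary initial one.\<close>

lemma ladmm_step_dual:
  assumes "convex_on UNIV f" "convex_on UNIV g" "entrywise_pos \<theta>" "entrywise_pos \<beta>"
  shows "snd (snd (ladmm_step f g A X (W, \<theta>, \<beta>) \<omega>))
    \<in> subgrad g (fst (snd (ladmm_step f g A X (W, \<theta>, \<beta>) \<omega>)))"
proof -
  obtain Z E M where \<omega>: "\<omega> = (Z, E, M)" by (cases \<omega>)
  obtain Z' E' M' where s: "ladmm_step f g A X (W, \<theta>, \<beta>) (Z, E, M) = (Z', E', M')"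
    by (metis prod_cases3)
  show ?thesis using ladmm_step_subgrad(2)[OF assms s] by (simp add: \<omega> s)
qed

section \<open>Transfer of the error bound to the scaled parameters\<close>

lemma norm_add_sq_le:
  fixes x y :: "'a::real_normed_vector"
  shows "(norm (x + y))\<^sup>2 \<le> 2 * (norm x)\<^sup>2 + 2 * (norm y)\<^sup>2"
proof -
  have "(norm (x + y))\<^sup>2 \<le> (norm x + norm y)\<^sup>2" by (intro power_mono norm_triangle_ineq) auto
  also have "\<dots> \<le> 2 * (norm x)\<^sup>2 + 2 * (norm y)\<^sup>2"
    using zero_le_power2[of "norm x - norm y"] by (simp add: power2_sum power2_diff)
  finally show ?thesis .
qed

text \<open>The distance of \<open>T' \<omega>\<close> to a solution is compared with that of
  \<open>T \<omega>\<close>, where the assumed bound applies. Every remaining error is a multiple of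
  the squared norm of \<open>T' \<omega> - \<omega>\<close>, which the coercive form of
  \<open>\<theta>'\<close> controls.\<close>

lemma error_bound_transfer:
  fixes A :: "real^'d^'m" and \<theta> \<theta>' :: "real^'n^'d" and \<beta> :: "real^'n^'m"
  assumes conv: "convex_on UNIV f" "convex_on UNIV g"
    and pos: "entrywise_pos \<theta>" "entrywise_pos \<theta>'" "entrywise_pos \<beta>"
    and ne: "Omega_star f g A X \<noteq> {}" and \<kappa>: "\<kappa> > 0"
    and c: "c > 0" "\<And>Z. c * (norm Z)\<^sup>2 \<le> Z \<bullet> Dop A A \<theta>' \<beta> Z"
  defines "T \<equiv> ladmm_step f g A X (A, \<theta>, \<beta>)" and "T' \<equiv> ladmm_step f g A X (A, \<theta>', \<beta>)"
  obtains L where "L > 0"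
    "\<And>\<omega>. dist2H f g A X (A, \<theta>, \<beta>) (T \<omega>) \<le> \<kappa> * Hnormsq A (A, \<theta>, \<beta>) (T \<omega> - \<omega>)
      \<Longrightarrow> dist2H f g A X (A, \<theta>', \<beta>) (T' \<omega>) \<le> L * Hnormsq A (A, \<theta>', \<beta>) (T' \<omega> - \<omega>)"
proof -
  let ?Q = "Hnormsq A (A, \<theta>, \<beta>)" and ?H = "Hnormsq A (A, \<theta>', \<beta>)"
  obtain C where C: "C > 0" "\<And>\<omega>. norm (T \<omega> - T' \<omega>) \<le> C * norm (T' \<omega> - \<omega>)"
    using ladmm_step_theta_compare[OF conv pos] unfolding T_def T'_def by blast
  obtain e where e: "e > 0" "\<And>\<omega>. e * (norm \<omega>)\<^sup>2 \<le> ?H \<omega>"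
    using Hnormsq_lower[OF pos(3) c] by blast
  obtain U where U: "U > 0" "\<And>\<omega>. \<bar>?H \<omega>\<bar> \<le> U * (norm \<omega>)\<^sup>2"
    using Hnormsq_upper by blast
  obtain V where V: "V > 0" "\<And>\<omega>. \<bar>?Q \<omega>\<bar> \<le> V * (norm \<omega>)\<^sup>2"
    using Hnormsq_upper by blast
  obtain a b where ab: "a > 0" "b > 0"
    "\<And>Z E M N. hprod \<beta> (A ** Z + E) = N \<Longrightarrow> (norm (Z, E, M))\<^sup>2 \<le> a * ?Q (Z, E, M) + b * (norm N)\<^sup>2"
    using Hnormsq_coercive_mod_residual[OF pos(1,3)] by blast
  \<comment> \<open>By the dual update and feasibility of the solution, the residual of the
    difference gives \<open>N = M - M'\<close>, up to sign a component of
    \<open>T \<omega> - \<omega>\<close>.\<close>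
  have coercive: "(norm (T \<omega> - \<omega>s))\<^sup>2 \<le> a * ?Q (T \<omega> - \<omega>s) + b * (norm (T \<omega> - \<omega>))\<^sup>2"
    if \<omega>s: "\<omega>s \<in> Omega_star f g A X" for \<omega> \<omega>s
  proof -
    obtain Z E M where \<omega>: "\<omega> = (Z, E, M)" by (cases \<omega>)
    obtain Zs Es Ms where s: "\<omega>s = (Zs, Es, Ms)" by (cases \<omega>s)
    obtain Z' E' M' where t: "T (Z, E, M) = (Z', E', M')" by (metis prod_cases3)
    have "M' = M - hprod \<beta> (A ** Z' + E' - X)"
      using ladmm_step_subgrad(3)[OF conv pos(1,3)] t unfolding T_def by blast
    moreover have "X = A ** Zs + Es" using \<omega>s by (auto simp: s Omega_star_iff)
    ultimately have "hprod \<beta> (A ** (Z' - Zs) + (E' - Es)) = M - M'"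
      by (simp add: linear_diff[OF linear_matrix_mult] algebra_simps)
    from ab(3)[OF this, of "M' - Ms"]
    have "(norm (T \<omega> - \<omega>s))\<^sup>2 \<le> a * ?Q (T \<omega> - \<omega>s) + b * (norm (M - M'))\<^sup>2"
      by (simp add: \<omega> s t)
    moreover have "(norm (M - M'))\<^sup>2 \<le> (norm (T \<omega> - \<omega>))\<^sup>2"
      by (simp add: \<omega> t norm_triple_sq norm_minus_commute[of M])
    ultimately show ?thesis
      using mult_left_mono[of "(norm (M - M'))\<^sup>2" "(norm (T \<omega> - \<omega>))\<^sup>2" b] ab(2) by linarith
  qed
  \<comment> \<open>\<open>B\<close> gathers the coefficients of the squared norm of
    \<open>T \<omega> - \<omega>\<close>, one from the residual and one from the error bound. In
    \<open>L\<close> this norm is exchanged for that of \<open>T' \<omega> - \<omega>\<close> at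
    cost \<open>2 * C\<^sup>2 + 2\<close>, and \<open>1 / e\<close> returns to the form of
    \<open>\<theta>'\<close>.\<close>
  define B where "B = 2 * U * b + 2 * U * a * (\<kappa> * V)"
  define L where "L = (B * (2 * C\<^sup>2 + 2) + 2 * U * C\<^sup>2) / e"
  have B: "B > 0" using U V ab \<kappa> by (simp add: B_def add_pos_pos)
  show ?thesis
  proof
    show "L > 0" using B C U e(1) by (simp add: L_def add_pos_pos)
    fix \<omega>
    assume EB: "dist2H f g A X (A, \<theta>, \<beta>) (T \<omega>) \<le> \<kappa> * ?Q (T \<omega> - \<omega>)"
    define \<delta> where "\<delta> = dist2H f g A X (A, \<theta>', \<beta>) (T' \<omega>)"
    define D where "D = (norm (T' \<omega> - \<omega>))\<^sup>2"
    have diff: "(norm (T' \<omega> - T \<omega>))\<^sup>2 \<le> C\<^sup>2 * D"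
      using power_mono[OF C(2)[of \<omega>], of 2] by (simp add: D_def power_mult_distrib norm_minus_commute)
    have step: "(norm (T \<omega> - \<omega>))\<^sup>2 \<le> (2 * C\<^sup>2 + 2) * D"
      using norm_add_sq_le[of "T \<omega> - T' \<omega>" "T' \<omega> - \<omega>"] diff
      by (simp add: D_def norm_minus_commute algebra_simps)
    have bdd: "bdd_below ((\<lambda>\<omega>s. ?H (\<omega>1 - \<omega>s)) ` Omega_star f g A X)" for \<omega>1
    proof (rule bdd_belowI2)
      show "0 \<le> ?H (\<omega>1 - \<omega>s)" for \<omega>s
        using e(2)[of "\<omega>1 - \<omega>s"] e(1) by (meson order_trans mult_nonneg_nonneg less_imp_le zero_le_power2)
    qed
    define r where "r = 2 * U * b * (norm (T \<omega> - \<omega>))\<^sup>2 + 2 * U * (C\<^sup>2 * D)"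
    have "\<delta> \<le> 2 * U * a * ?Q (T \<omega> - \<omega>s) + r" if \<omega>s: "\<omega>s \<in> Omega_star f g A X" for \<omega>s
    proof -
      have "\<delta> \<le> ?H (T' \<omega> - \<omega>s)"
        unfolding \<delta>_def dist2H_def by (rule cINF_lower[OF bdd \<omega>s])
      also have "\<dots> \<le> U * (norm (T' \<omega> - \<omega>s))\<^sup>2" using U(2)[of "T' \<omega> - \<omega>s"] by simp
      also have "\<dots> \<le> U * (2 * (norm (T' \<omega> - T \<omega>))\<^sup>2 + 2 * (norm (T \<omega> - \<omega>s))\<^sup>2)"
        using norm_add_sq_le[of "T' \<omega> - T \<omega>" "T \<omega> - \<omega>s"] U(1) by (intro mult_left_mono) auto
      also have "\<dots> \<le> U * (2 * (C\<^sup>2 * D) + 2 * (a * ?Q (T \<omega> - \<omega>s) + b * (norm (T \<omega> - \<omega>))\<^sup>2))"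
        using diff coercive[OF \<omega>s, of \<omega>] U(1) by (intro mult_left_mono add_mono) auto
      finally show ?thesis by (simp add: r_def algebra_simps)
    qed
    \<comment> \<open>Solving for the possibly indefinite form \<open>?Q\<close> gives a lower bound
      uniform in the solution, which passes to the infimum.\<close>
    then have "(\<delta> - r) / (2 * U * a) \<le> ?Q (T \<omega> - \<omega>s)" if "\<omega>s \<in> Omega_star f g A X" for \<omega>s
      using that U(1) ab(1) by (simp add: pos_divide_le_eq algebra_simps)
    then have "(\<delta> - r) / (2 * U * a) \<le> dist2H f g A X (A, \<theta>, \<beta>) (T \<omega>)"
      unfolding dist2H_def by (intro cINF_greatest ne)
    also have "\<dots> \<le> \<kappa> * (V * (norm (T \<omega> - \<omega>))\<^sup>2)"
      using EB V(2)[of "T \<omega> - \<omega>"] \<kappa> by (smt (verit) mult_left_mono)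
    finally have "\<delta> \<le> B * (norm (T \<omega> - \<omega>))\<^sup>2 + 2 * U * C\<^sup>2 * D"
      using U(1) ab(1) by (simp add: pos_divide_le_eq r_def B_def algebra_simps)
    also have "\<dots> \<le> B * ((2 * C\<^sup>2 + 2) * D) + 2 * U * C\<^sup>2 * D"
      using step B by simp
    also have "\<dots> = L * e * D"
    proof -
      have "L * e = B * (2 * C\<^sup>2 + 2) + 2 * U * C\<^sup>2" using e(1) by (simp add: L_def)
      then show ?thesis by (simp only:) (simp add: algebra_simps)
    qed
    also have "\<dots> = L * (e * D)" by simp
    also have "\<dots> \<le> L * ?H (T' \<omega> - \<omega>)"
      using e(2)[of "T' \<omega> - \<omega>"] \<open>L > 0\<close> by (simp add: D_def)
    finally show "dist2H f g A X (A, \<theta>', \<beta>) (T' \<omega>) \<le> L * ?H (T' \<omega> - \<omega>)" by (simp add: \<delta>_def)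
  qed
qed

section \<open>Choice of the parameters and linear convergence\<close>

text \<open>In \<open>t = 1 + K / c\<close> the summand \<open>K / c\<close> absorbs the term with
  \<open>transpose A\<close>, bounded by \<open>K\<close>, and the summand 1 keeps the coercivity of
  \<open>\<theta>\<close>.\<close>

lemma Dop_coercive_scaled:
  fixes A :: "real^'d^'m" and \<theta> :: "real^'n^'d" and \<beta> :: "real^'n^'m"
  assumes "entrywise_pos \<theta>"
  obtains t c where "t > 0" "c > 0" "\<And>Z. c * (norm Z)\<^sup>2 \<le> Z \<bullet> Dop A A (t *\<^sub>R \<theta>) \<beta> Z"
proof -
  obtain c where c: "c > 0" "\<And>x. c * (norm x)\<^sup>2 \<le> x \<bullet> hprod \<theta> x"
    using entrywise_pos_coercive[OF assms] by blast
  obtain K where K: "K > 0" "\<And>x::real^'n^'d. norm (transpose A ** hprod \<beta> (A ** x)) \<le> K * norm x"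
    using linear_norm_bound[OF linear_compose[OF linear_compose[OF linear_matrix_mult linear_hprod] linear_matrix_mult]]
    by (metis comp_apply)
  show ?thesis
  proof
    show "1 + K / c > 0" "c > 0" using c K by (auto intro: add_pos_pos)
    fix Z :: "real^'n^'d"
    have "Z \<bullet> (transpose A ** hprod \<beta> (A ** Z)) \<le> norm Z * (K * norm Z)"
      by (rule order_trans[OF norm_cauchy_schwarz]) (intro mult_left_mono K, simp)
    moreover have "(1 + K / c) * (c * (norm Z)\<^sup>2) \<le> (1 + K / c) * (Z \<bullet> hprod \<theta> Z)"
      using c K by (intro mult_left_mono) (auto intro: add_nonneg_nonneg)
    moreover have "(1 + K / c) * (c * (norm Z)\<^sup>2) = c * (norm Z)\<^sup>2 + norm Z * (K * norm Z)"
      using c(1) by (simp add: field_simps power2_eq_square)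
    ultimately show "c * (norm Z)\<^sup>2 \<le> Z \<bullet> Dop A A ((1 + K / c) *\<^sub>R \<theta>) \<beta> Z"
      by (simp add: Dop_def hprod_scaleR_left inner_diff_right)
  qed
qed

theorem theorem3:
  fixes f :: "(real^'n^'d) \<Rightarrow> real" and g :: "(real^'n^'m) \<Rightarrow> real"
    and A :: "(real^'d^'m)" and X :: "(real^'n^'m)"
    and c \<sigma> \<kappa> :: real and K0 :: nat
    and \<theta>s :: "(real^'n^'d)" and \<beta>s :: "(real^'n^'m)"
    and \<omega>0 :: "(real^'n^'d) \<times> (real^'n^'m) \<times> (real^'n^'m)"
  assumes "convex_on UNIV f" and "convex_on UNIV g"
    and standing: "\<forall>s. 0 \<le> s \<and> s \<le> c \<longrightarrow> Sset s A \<noteq> {}"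
    and "Omega_star f g A X \<noteq> {}"
    and "0 \<le> \<sigma>" and "\<sigma> \<le> c"
    and "entrywise_pos \<theta>s" and "entrywise_pos \<beta>s"
    and "\<kappa> > 0" and "K0 > 0"
    and EB: "\<forall>P. (\<forall>k. P k \<in> Sset \<sigma> A) \<longrightarrow>
       (\<forall>k\<ge>K0. dist2H f g A X (A, \<theta>s, \<beta>s)
                   (ladmm_step f g A X (A, \<theta>s, \<beta>s) (ladmm_seq f g A X P \<omega>0 k))
                 \<le> \<kappa> / 16 * Hnormsq A (A, \<theta>s, \<beta>s)
                   (ladmm_step f g A X (A, \<theta>s, \<beta>s) (ladmm_seq f g A X P \<omega>0 k)
                    - ladmm_seq f g A X P \<omega>0 k))"
  shows "\<exists>P \<gamma>. (\<forall>k. P k \<in> Sset \<sigma> A) \<and> 0 < \<gamma> \<and> \<gamma> < 1 \<and>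
    (\<forall>k\<ge>K0.
       dist2H f g A X (P (Suc k)) (ladmm_seq f g A X P \<omega>0 (Suc k))
         < \<gamma> * dist2H f g A X (P k) (ladmm_seq f g A X P \<omega>0 k)
     \<or> (dist2H f g A X (P k) (ladmm_seq f g A X P \<omega>0 k) = 0 \<and>
        dist2H f g A X (P (Suc k)) (ladmm_seq f g A X P \<omega>0 (Suc k)) = 0))"
proof -
  have conv: "convex_on UNIV f" "convex_on UNIV g" by fact+
  have pos: "entrywise_pos \<theta>s" "entrywise_pos \<beta>s" by fact+
  obtain t c' where t: "t > 0" and c': "c' > 0" "\<And>Z. c' * (norm Z)\<^sup>2 \<le> Z \<bullet> Dop A A (t *\<^sub>R \<theta>s) \<beta>s Z"
    using Dop_coercive_scaled[OF pos(1)] by blast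
  define \<theta>' where "\<theta>' = t *\<^sub>R \<theta>s"
  note coercive = c'(2)[folded \<theta>'_def]
  have pos': "entrywise_pos \<theta>'" using pos(1) t by (simp add: \<theta>'_def entrywise_pos_def)
  \<comment> \<open>One triple for all steps keeps the form fixed, so that distances at consecutive
    iterates are comparable; \<open>W = A\<close> has spectral distance 0 from
    \<open>A\<close>.\<close>
  define p where "p = (A, \<theta>', \<beta>s)"
  define w where "w = ladmm_seq f g A X (\<lambda>_. p) \<omega>0"
  have w_Suc: "w (Suc k) = ladmm_step f g A X (A, \<theta>', \<beta>s) (w k)" for k by (simp add: w_def p_def)
  let ?H = "Hnormsq A (A, \<theta>', \<beta>s)" and ?d = "dist2H f g A X (A, \<theta>', \<beta>s)"
  have pS: "p \<in> Sset \<sigma> A"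
  proof -
    have "frob (Dop A A \<theta>' \<beta>s Z) Z > 0" if "Z \<noteq> 0" for Z
      using coercive[of Z] c'(1) that
      by (metis frob_eq_inner inner_commute less_le_trans mult_pos_pos zero_less_norm_iff zero_less_power)
    moreover have "onorm (\<lambda>x. (A - A) *v x) \<le> \<sigma>"
      using \<open>0 \<le> \<sigma>\<close> by (simp add: onorm_zero)
    ultimately show ?thesis using pos pos' unfolding p_def Sset_def by blast
  qed
  obtain e where e: "e > 0" "\<And>\<omega>. e * (norm \<omega>)\<^sup>2 \<le> ?H \<omega>"
    by (rule Hnormsq_lower[OF pos(2) c'(1) coercive]) (rule that)
  have H_nonneg: "0 \<le> ?H \<omega>" for \<omega>
    using e(2)[of \<omega>] e(1) by (meson order_trans mult_nonneg_nonneg less_imp_le zero_le_power2)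
  have \<kappa>: "\<kappa> / 16 > 0" using \<open>\<kappa> > 0\<close> by simp
  obtain L where L: "L > 0"
    "\<And>\<omega>. dist2H f g A X (A, \<theta>s, \<beta>s) (ladmm_step f g A X (A, \<theta>s, \<beta>s) \<omega>)
        \<le> \<kappa> / 16 * Hnormsq A (A, \<theta>s, \<beta>s) (ladmm_step f g A X (A, \<theta>s, \<beta>s) \<omega> - \<omega>)
      \<Longrightarrow> ?d (ladmm_step f g A X (A, \<theta>', \<beta>s) \<omega>) \<le> L * ?H (ladmm_step f g A X (A, \<theta>', \<beta>s) \<omega> - \<omega>)"
    by (rule error_bound_transfer[OF conv pos(1) pos' pos(2) \<open>Omega_star f g A X \<noteq> {}\<close> \<kappa> c'(1) coercive])
       (rule that)
  have d_nonneg: "0 \<le> ?d \<omega>" for \<omega>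
    unfolding dist2H_def by (intro cINF_greatest assms H_nonneg)
  have bdd: "bdd_below ((\<lambda>\<omega>s. ?H (\<omega> - \<omega>s)) ` Omega_star f g A X)" for \<omega>
    by (rule bdd_belowI2) (rule H_nonneg)
  have decr: "(L + 1) * ?d (w (Suc k)) \<le> L * ?d (w k)" if k: "k \<ge> K0" for k
  proof -
    \<comment> \<open>\<open>K0 > 0\<close> makes \<open>w k\<close> the output of a step, so
      \<open>dual\<close> is available.\<close>
    have "k = Suc (k - 1)" using k \<open>K0 > 0\<close> by simp
    then have dual: "snd (snd (w k)) \<in> subgrad g (fst (snd (w k)))"
      using ladmm_step_dual[OF conv pos' pos(2)] w_Suc by metis
    \<comment> \<open>The contraction holds for each solution; bounding the new distance by any of
      them and taking the infimum on the right avoids choosing a nearest solution.\<close>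
    have "?d (w (Suc k)) + ?H (w (Suc k) - w k) \<le> ?d (w k)"
      unfolding dist2H_def[of _ _ _ _ _ "w k"]
    proof (rule cINF_greatest)
      fix \<omega>s assume \<omega>s: "\<omega>s \<in> Omega_star f g A X"
      have "?d (w (Suc k)) \<le> ?H (w (Suc k) - \<omega>s)"
        unfolding dist2H_def by (rule cINF_lower[OF bdd \<omega>s])
      then show "?d (w (Suc k)) + ?H (w (Suc k) - w k) \<le> ?H (w k - \<omega>s)"
        using ladmm_step_contraction[OF conv pos' pos(2) \<omega>s dual] unfolding w_Suc by linarith
    qed fact
    moreover have "?d (w (Suc k)) \<le> L * ?H (w (Suc k) - w k)"
      unfolding w_Suc using EB[rule_format, of "\<lambda>_. p", OF pS k] by (intro L(2)) (simp add: w_def)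
    \<comment> \<open>Adding \<open>L\<close> times the contraction to the transferred bound
      eliminates the displacement term.\<close>
    ultimately show ?thesis
      using mult_left_mono[of "?d (w (Suc k)) + ?H (w (Suc k) - w k)" "?d (w k)" L] L(1)
      by (simp add: algebra_simps)
  qed
  \<comment> \<open>A value strictly between \<open>L / (L + 1)\<close> and 1 makes the decrease
    strict while the distance is positive; a zero distance stays zero.\<close>
  define \<gamma> where "\<gamma> = (L + 1) / (L + 2)"
  have \<gamma>: "0 < \<gamma>" "\<gamma> < 1" "L / (L + 1) < \<gamma>"
    using L(1) by (auto simp: \<gamma>_def field_simps)
  have "?d (w (Suc k)) < \<gamma> * ?d (w k) \<or> ?d (w k) = 0 \<and> ?d (w (Suc k)) = 0" if "k \<ge> K0" for k
  proof -
    have le: "?d (w (Suc k)) \<le> L / (L + 1) * ?d (w k)"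
      using decr[OF that] L(1) by (simp add: field_simps)
    show ?thesis
    proof (cases "?d (w k) = 0")
      case True
      then show ?thesis using le d_nonneg[of "w (Suc k)"] by auto
    next
      case False
      then have "L / (L + 1) * ?d (w k) < \<gamma> * ?d (w k)"
        using \<gamma>(3) d_nonneg[of "w k"] by (intro mult_strict_right_mono) auto
      then show ?thesis using le by linarith
    qed
  qed
  then show ?thesis
    using pS \<gamma>(1,2) by (intro exI[of _ "\<lambda>_. p"] exI[of _ \<gamma>]) (simp add: w_def p_def)
qed

end
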